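(* For positive integers $n$, $\operatorname{ept}(K_n)=\Theta(\log\log n)$ as $n\to\infty$; that is, there exist constants $c_1,c_2>0$ and $n_0$ such that $c_1\log\log n\le \operatorname{ept}(K_n)\le c_2\log\log n$ for all $n\ge n_0$, where $K_n$ is the complete graph on $n$ vertices.
   Context: Graphs are finite, simple and undirected. $N[u]=N(u)\cup\{u\}$ is the closed neighborhood of $u$. Probabilistic zero forcing: each vertex of a connected graph $G$ is blue or white. In one round, with $C$ the set of vertices that are blue at the start of the round, every blue vertex $u$ attempts to force each of its white neighbors $w$, all attempts being independent, each succeeding with probability $\Pr(u\to w)=\frac{|N[u]\cap C|}{\deg u}$. A white vertex becomes blue in the round if at least one blue neighbor succeeds in forcing it; blue vertices stay blue. For a nonempty set $B$ of vertices, $\operatorname{pt}_{pzf}(G,B)$ is the random number of the round in which the last white vertex turns blue when initially exactly the vertices in $B$ are blue (it is $0$ if $B=V(G)$), and $\operatorname{ept}(G,B)=\mathbf{E}[\operatorname{pt}_{pzf}(G,B)]$. The expected propagation time of $G$ is $\operatorname{ept}(G)=\min\{\operatorname{ept}(G,\{v\}):v\in V(G)\}$. *)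

theory Defs
  imports "HOL-Probability.Probability" "Graph_Theory.Kuratowski"
begin

text \<open>A finite simple undirected graph is a \<open>pair_graph\<close>: each undirected edge is
  represented by its two opposite arcs.\<close>

definition nbhd :: "'a pair_pre_digraph \<Rightarrow> 'a \<Rightarrow> 'a set" where
  "nbhd G u = {w. (u, w) \<in> parcs G}"

definition closed_nbhd :: "'a pair_pre_digraph \<Rightarrow> 'a \<Rightarrow> 'a set" where
  "closed_nbhd G u = insert u (nbhd G u)"

definition vdegree :: "'a pair_pre_digraph \<Rightarrow> 'a \<Rightarrow> nat" where
  "vdegree G u = card (nbhd G u)"

definition complete_pair_graph :: "nat \<Rightarrow> nat pair_pre_digraph" where
  "complete_pair_graph n = \<lparr> pverts = {..<n}, parcs = {(u, v). u < n \<and> v < n \<and> u \<noteq> v} \<rparr>"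

lemma complete_pair_graph_simps [simp]:
  "pverts (complete_pair_graph n) = {..<n}"
  "parcs (complete_pair_graph n) = {(u, v). u < n \<and> v < n \<and> u \<noteq> v}"
  by (simp_all add: complete_pair_graph_def)

lemma pair_graph_complete: "pair_graph (complete_pair_graph n)"
proof
  show "finite (parcs (complete_pair_graph n))"
    by (rule finite_subset[of _ "{..<n} \<times> {..<n}"]) auto
qed (auto simp: symmetric_def intro: symI)

lemma complete_digraph_complete: "complete_digraph n (with_proj (complete_pair_graph n))"
  using pair_graph_complete[of n]
  by (auto simp: complete_digraph_def intro: pair_graph.pair_graphD_graph)


text \<open>\<open>force_prob G C u\<close> is $\Pr(u \to w)$, which does not depend on the white neighbour $w$,
  when \<open>C\<close> is the set of blue vertices at the start of the round.\<close>

definition force_prob :: "'a pair_pre_digraph \<Rightarrow> 'a set \<Rightarrow> 'a \<Rightarrow> real" where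
  "force_prob G C u = real (card (closed_nbhd G u \<inter> C)) / real (vdegree G u)"

lemma force_prob_bounds:
  assumes "pair_graph G" "u \<in> C" "w \<notin> C" "(u, w) \<in> parcs G"
  shows "0 < force_prob G C u" "force_prob G C u \<le> 1"
proof -
  interpret pair_graph G by fact
  have fin: "finite (nbhd G u)"
    using pair_finite_verts by (rule finite_subset[rotated]) (auto simp: nbhd_def arc_snd_in_verts dest: wellformed)
  have w: "w \<in> nbhd G u" using assms(4) by (simp add: nbhd_def)
  have "card (closed_nbhd G u \<inter> C) \<le> card (insert u (nbhd G u - {w}))"
    using fin assms(3) by (intro card_mono) (auto simp: closed_nbhd_def)
  also have "\<dots> \<le> Suc (card (nbhd G u - {w}))"
    by (simp add: card_insert_le_m1 card_insert_if fin)
  also have "\<dots> = vdegree G u"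
    unfolding vdegree_def using fin w by (rule card_Suc_Diff1)
  finally have le: "card (closed_nbhd G u \<inter> C) \<le> vdegree G u" .
  have "vdegree G u > 0" using fin w by (auto simp: vdegree_def card_gt_0_iff)
  moreover have "card (closed_nbhd G u \<inter> C) > 0"
    using fin assms(2) by (auto simp: card_gt_0_iff closed_nbhd_def)
  ultimately show "0 < force_prob G C u" "force_prob G C u \<le> 1"
    using le by (simp_all add: force_prob_def)
qed


text \<open>The randomness of one round is a family \<open>x\<close> of independent uniform random variables on
  $[0,1]$, one for every ordered pair \<open>(u, w)\<close> of vertices. An attempt of \<open>u\<close> to force \<open>w\<close> is
  successful iff \<open>x (u, w)\<close> lies below the forcing probability; thus, given the current
  blue set, the attempts are independent and have the prescribed success probabilities.\<close>

definition pzf_round_space :: "'a pair_pre_digraph \<Rightarrow> ('a \<times> 'a \<Rightarrow> real) measure" where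
  "pzf_round_space G =
     (\<Pi>\<^sub>M e \<in> pverts G \<times> pverts G. uniform_measure lborel {0..1})"

definition pzf_round ::
    "'a pair_pre_digraph \<Rightarrow> 'a set \<Rightarrow> ('a \<times> 'a \<Rightarrow> real) \<Rightarrow> 'a set" where
  "pzf_round G C x =
     C \<union> {w \<in> pverts G - C. \<exists>u\<in>C. (u, w) \<in> parcs G \<and> x (u, w) < force_prob G C u}"

text \<open>Different rounds use independent copies of this randomness.\<close>

definition pzf_space :: "'a pair_pre_digraph \<Rightarrow> ('a \<times> 'a \<Rightarrow> real) stream measure" where
  "pzf_space G = stream_space (pzf_round_space G)"

primrec pzf_blue ::
    "'a pair_pre_digraph \<Rightarrow> 'a set \<Rightarrow> ('a \<times> 'a \<Rightarrow> real) stream \<Rightarrow> nat \<Rightarrow> 'a set" where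
  "pzf_blue G B \<omega> 0 = B"
| "pzf_blue G B \<omega> (Suc t) = pzf_round G (pzf_blue G B \<omega> t) (\<omega> !! t)"

text \<open>The propagation time is \<open>\<infinity>\<close> on those outcomes where some vertex stays white forever.\<close>

definition pt_pzf ::
    "'a pair_pre_digraph \<Rightarrow> 'a set \<Rightarrow> ('a \<times> 'a \<Rightarrow> real) stream \<Rightarrow> ennreal" where
  "pt_pzf G B \<omega> = (INF t \<in> {t. pzf_blue G B \<omega> t = pverts G}. of_nat t)"

definition ept_from :: "'a pair_pre_digraph \<Rightarrow> 'a set \<Rightarrow> ennreal" where
  "ept_from G B = (\<integral>\<^sup>+ \<omega>. pt_pzf G B \<omega> \<partial>pzf_space G)"

definition ept :: "'a pair_pre_digraph \<Rightarrow> ennreal" where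
  "ept G = (MIN v \<in> pverts G. ept_from G {v})"

end

theory Submission
  imports Defs "HOL-Real_Asymp.Real_Asymp"
begin

text \<open>If $k$ of the $n$ vertices are blue, the expected number of blue vertices after one
  round is at most $k + k^2 \le 2k^2$. Hence, by concavity, $\ln(1 + \ln X_t)$ grows by at most 1
  per round in expectation, and Markov's inequality gives the lower bound. Conversely, with
  probability bounded below, a round multiplies the number of blue vertices by at least
  $1 + k/16$ as long as $k^2 < n$, then raises it to $n/8$, and then colours everything. Each
  such success adds a constant to a potential that is $\ln(1 + \ln k)$ in the first phase, so that
  a drift argument yields the upper bound.\<close>

section \<open>Drift bounds for the propagation time\<close>

text \<open>The obstacle for the upper bound is the start: with few blue vertices among many, a
  round changes nothing with probability bounded away from 0, so no run of good rounds can be taken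
  for granted. A drift inequality averages over the waiting times instead. It is applied with one
  gain and one success probability for all phases: a good round gains 1/49 of potential, and a round
  is bad with probability at most 16/17, a bound for exp(-1/16) that stems from a single blue
  vertex. On the complete graph the white vertices escape independently and with equal probability,
  so every estimate for one round derives from the probability that a given white set stays
  white.\<close>

lemma prob_space_pzf_round_space: "prob_space (pzf_round_space G)"
  unfolding pzf_round_space_def
  by (intro prob_space_PiM prob_space_uniform_measure) auto

lemma prob_space_pzf_space: "prob_space (pzf_space G)"
  unfolding pzf_space_def
  by (rule prob_space.prob_space_stream_space[OF prob_space_pzf_round_space])

lemma sets_pzf_round_space: "sets (pzf_round_space G) = sets (\<Pi>\<^sub>M e \<in> pverts G \<times> pverts G. borel)"
  unfolding pzf_round_space_def by (intro sets_PiM_cong) auto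

lemma pzf_round_superset: "C \<subseteq> pzf_round G C x"
  by (auto simp: pzf_round_def)

lemma pzf_round_subset: "C \<subseteq> pverts G \<Longrightarrow> pzf_round G C x \<subseteq> pverts G"
  by (auto simp: pzf_round_def)

lemma pzf_round_pverts [simp]: "pzf_round G (pverts G) x = pverts G"
  by (auto simp: pzf_round_def)

lemma pzf_blue_pverts_mono:
  "pzf_blue G B \<omega> s = pverts G \<Longrightarrow> s \<le> t \<Longrightarrow> pzf_blue G B \<omega> t = pverts G"
  by (rotate_tac, induction t rule: dec_induct) auto

text \<open>\<open>pzf_blue\<close> recurses on the last round, while integration over
  \<open>stream_space\<close> splits off the first one; this identity reconciles the two.\<close>

lemma pzf_blue_Stream:
  "pzf_blue G B (x ## \<omega>) (Suc t) = pzf_blue G (pzf_round G B x) \<omega> t"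
  by (induction t) simp_all

text \<open>The target is finite, so preimages of single sets suffice, and each of these is a finite
  Boolean combination of threshold events for coordinates.\<close>

lemma measurable_pzf_round:
  assumes fin: "finite (pverts G)" and C: "C \<subseteq> pverts G"
  shows "pzf_round G C \<in> measurable (pzf_round_space G) (count_space (Pow (pverts G)))"
  unfolding measurable_count_space_eq2[OF finite_Pow_iff[THEN iffD2, OF fin]]
proof (intro conjI ballI)
  show "pzf_round G C \<in> space (pzf_round_space G) \<rightarrow> Pow (pverts G)"
    using pzf_round_subset[OF C] by blast
next
  fix D
  have finC: "finite C" using fin C finite_subset by blast
  have comp: "Measurable.pred (pzf_round_space G) (\<lambda>x. x (u, w) < c)"
    if "u \<in> C" "w \<in> pverts G" for u w c
  proof -
    have "(\<lambda>x. x (u, w)) \<in> borel_measurable (pzf_round_space G)"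
      using that C by (subst measurable_cong_sets[OF sets_pzf_round_space refl])
        (auto intro!: measurable_component_singleton)
    thus ?thesis by measurable
  qed
  have mem: "Measurable.pred (pzf_round_space G) (\<lambda>x. w \<in> pzf_round G C x)"
    if "w \<in> pverts G" for w
  proof -
    have "(\<lambda>x. w \<in> pzf_round G C x) =
        (\<lambda>x. w \<in> C \<or> (\<exists>u\<in>C. (u, w) \<in> parcs G \<and> x (u, w) < force_prob G C u))"
      using that by (auto simp: pzf_round_def)
    moreover have "Measurable.pred (pzf_round_space G) \<dots>"
      using that finC by (intro pred_intros_logic pred_intros_finite) (auto intro: comp)
    ultimately show ?thesis by simp
  qed
  have "pzf_round G C -` {D} \<inter> space (pzf_round_space G) =
      {x \<in> space (pzf_round_space G). D \<subseteq> pverts G \<and> (\<forall>w\<in>pverts G. (w \<in> pzf_round G C x) = (w \<in> D))}"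
    using pzf_round_subset[OF C] by blast
  also have "\<dots> \<in> sets (pzf_round_space G)"
    unfolding pred_def[symmetric]
    using fin by (intro pred_intros_logic pred_intros_finite) (auto intro: mem)
  finally show "pzf_round G C -` {D} \<inter> space (pzf_round_space G) \<in> sets (pzf_round_space G)" .
qed

lemma measurable_pzf_blue:
  assumes fin: "finite (pverts G)" and B: "B \<subseteq> pverts G"
  shows "(\<lambda>\<omega>. pzf_blue G B \<omega> t) \<in> measurable (pzf_space G) (count_space (Pow (pverts G)))"
proof (induction t)
  case 0
  show ?case using B by simp
next
  case (Suc t)
  \<comment> \<open>The set entering round \<open>t\<close> is itself random; it is first frozen to
    one of its finitely many values \<open>C\<close>.\<close>
  have "(\<lambda>\<omega>. pzf_round G C (\<omega> !! t)) \<in> measurable (pzf_space G) (count_space (Pow (pverts G)))"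
    if "C \<in> Pow (pverts G)" for C
    unfolding pzf_space_def
    by (rule measurable_compose[OF measurable_snth measurable_pzf_round]) (use that fin in auto)
  from measurable_compose_countable'[OF this Suc] fin show ?case
    by (simp add: countable_finite)
qed

lemma borel_measurable_pzf_round:
  assumes "finite (pverts G)" "C \<subseteq> pverts G"
  shows "(\<lambda>x. f (pzf_round G C x)) \<in> measurable (pzf_round_space G) borel"
  by (rule measurable_compose[OF measurable_pzf_round]) (use assms in auto)

lemma borel_measurable_pzf_blue:
  assumes "finite (pverts G)" "B \<subseteq> pverts G"
  shows "(\<lambda>\<omega>. f (pzf_blue G B \<omega> t)) \<in> measurable (pzf_space G) borel"
  by (rule measurable_compose[OF measurable_pzf_blue]) (use assms in auto)

lemma nn_integral_pzf_blue_0: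
  "(\<integral>\<^sup>+ \<omega>. f (pzf_blue G B \<omega> 0) \<partial>pzf_space G) = f B"
  using prob_space.emeasure_space_1[OF prob_space_pzf_space, of G] by simp

text \<open>The Markov property: after the first round the process restarts from the new blue set
  with fresh randomness.\<close>

lemma nn_integral_pzf_blue_Suc:
  fixes f :: "'a set \<Rightarrow> ennreal"
  assumes "finite (pverts G)" "B \<subseteq> pverts G"
  shows "(\<integral>\<^sup>+ \<omega>. f (pzf_blue G B \<omega> (Suc t)) \<partial>pzf_space G) =
    (\<integral>\<^sup>+ x. (\<integral>\<^sup>+ \<omega>. f (pzf_blue G (pzf_round G B x) \<omega> t) \<partial>pzf_space G) \<partial>pzf_round_space G)"
proof -
  interpret prob_space "pzf_round_space G" by (rule prob_space_pzf_round_space)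
  show ?thesis
    using borel_measurable_pzf_blue[OF assms, of f "Suc t"] unfolding pzf_space_def
    by (subst nn_integral_stream_space) (simp_all add: pzf_blue_Stream del: pzf_blue.simps)
qed

text \<open>The right side counts the rounds that start with a white vertex. Its integral is a
  series of probabilities, which the drift argument can bound term by term.\<close>

lemma pt_pzf_le_suminf:
  "pt_pzf G B \<omega> \<le> (\<Sum>t. of_bool (pzf_blue G B \<omega> t \<noteq> pverts G) :: ennreal)"
proof (cases "\<exists>t. pzf_blue G B \<omega> t = pverts G")
  case True
  define t where "t = (LEAST t. pzf_blue G B \<omega> t = pverts G)"
  have t: "pzf_blue G B \<omega> t = pverts G" "\<And>s. s < t \<Longrightarrow> pzf_blue G B \<omega> s \<noteq> pverts G"
    unfolding t_def by (rule LeastI_ex[OF True], rule not_less_Least)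
  have "pt_pzf G B \<omega> \<le> of_nat t"
    unfolding pt_pzf_def using t(1) by (intro INF_lower) auto
  also have "\<dots> = (\<Sum>s<t. of_bool (pzf_blue G B \<omega> s \<noteq> pverts G))"
    using t(2) by simp
  also have "\<dots> \<le> (\<Sum>s. of_bool (pzf_blue G B \<omega> s \<noteq> pverts G))"
    by (intro sum_le_suminf) auto
  finally show ?thesis .
next
  case False
  have "(\<Sum>s. of_bool (pzf_blue G B \<omega> s \<noteq> pverts G) :: ennreal) = (\<Sum>s::nat. 1)"
    using False by (intro suminf_cong) auto
  also have "\<dots> = \<infinity>"
    using summable_iff_suminf_neq_top[of "\<lambda>_. 1"] by (simp add: summable_const_iff)
  finally show ?thesis by simp
qed

lemma Suc_le_pt_pzf:
  assumes "pzf_blue G B \<omega> t \<noteq> pverts G"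
  shows "of_nat (Suc t) \<le> pt_pzf G B \<omega>"
  unfolding pt_pzf_def
proof (rule INF_greatest)
  fix s assume "s \<in> {t. pzf_blue G B \<omega> t = pverts G}"
  hence "\<not> s \<le> t" using pzf_blue_pverts_mono assms by blast
  thus "of_nat (Suc t) \<le> (of_nat s :: ennreal)"
    by (intro of_nat_mono) simp
qed

text \<open>Additive drift: the nonnegative potential \<open>h\<close> loses at least 1 in
  expectation in every unfinished round, so the expected number of such rounds is at most its
  initial value. Counting only the first \<open>t\<close> rounds turns this into an induction on
  \<open>t\<close> over all starting sets, by conditioning on the first round; then \<open>t\<close>
  tends to infinity.\<close>

lemma ept_from_le_drift:
  fixes h :: "'a set \<Rightarrow> ennreal"
  assumes fin: "finite (pverts G)" and B: "B \<subseteq> pverts G" "B \<noteq> {}"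
    and drift: "\<And>C. C \<subset> pverts G \<Longrightarrow> C \<noteq> {} \<Longrightarrow>
      1 + (\<integral>\<^sup>+ x. h (pzf_round G C x) \<partial>pzf_round_space G) \<le> h C"
  shows "ept_from G B \<le> h B"
proof -
  define W where "W = (\<lambda>C. of_bool (C \<noteq> pverts G) :: ennreal)"
  have meas: "(\<lambda>\<omega>. W (pzf_blue G C \<omega> t)) \<in> borel_measurable (pzf_space G)"
    if "C \<subseteq> pverts G" for C t
    using fin that by (rule borel_measurable_pzf_blue)
  have "(\<Sum>s<t. \<integral>\<^sup>+ \<omega>. W (pzf_blue G C \<omega> s) \<partial>pzf_space G) \<le> h C"
    if "C \<subseteq> pverts G" "C \<noteq> {}" for C t
    using that
  proof (induction t arbitrary: C)
    case 0
    show ?case by simp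
  next
    case (Suc t)
    show ?case
    proof (cases "C = pverts G")
      case True
      have "pzf_blue G (pverts G) \<omega> s = pverts G" for \<omega> s
        by (induction s) auto
      thus ?thesis using True by (simp add: W_def del: sum.lessThan_Suc)
    next
      case False
      have "(\<Sum>s<Suc t. \<integral>\<^sup>+ \<omega>. W (pzf_blue G C \<omega> s) \<partial>pzf_space G) =
          W C + (\<Sum>s<t. \<integral>\<^sup>+ \<omega>. W (pzf_blue G C \<omega> (Suc s)) \<partial>pzf_space G)"
        by (simp only: sum.lessThan_Suc_shift nn_integral_pzf_blue_0)
      also have "(\<Sum>s<t. \<integral>\<^sup>+ \<omega>. W (pzf_blue G C \<omega> (Suc s)) \<partial>pzf_space G) =
          (\<integral>\<^sup>+ x. (\<Sum>s<t. \<integral>\<^sup>+ \<omega>. W (pzf_blue G (pzf_round G C x) \<omega> s) \<partial>pzf_space G) \<partial>pzf_round_space G)"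
        unfolding nn_integral_pzf_blue_Suc[OF fin Suc.prems(1)]
        by (intro nn_integral_sum[symmetric])
          (rule borel_measurable_pzf_round[OF fin Suc.prems(1)])
      also have "\<dots> \<le> (\<integral>\<^sup>+ x. h (pzf_round G C x) \<partial>pzf_round_space G)"
        using Suc.prems pzf_round_superset[of C G]
        by (intro nn_integral_mono Suc.IH pzf_round_subset) blast+
      finally have "(\<Sum>s<Suc t. \<integral>\<^sup>+ \<omega>. W (pzf_blue G C \<omega> s) \<partial>pzf_space G) \<le>
          W C + (\<integral>\<^sup>+ x. h (pzf_round G C x) \<partial>pzf_round_space G)"
        by (simp add: add_left_mono)
      also have "\<dots> \<le> h C"
        using drift[of C] Suc.prems False by (auto simp: W_def)
      finally show ?thesis .
    qed
  qed
  hence "(\<Sum>t. \<integral>\<^sup>+ \<omega>. W (pzf_blue G B \<omega> t) \<partial>pzf_space G) \<le> h B"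
    using B by (intro suminf_le_const) auto
  moreover have "ept_from G B \<le> (\<integral>\<^sup>+ \<omega>. (\<Sum>t. W (pzf_blue G B \<omega> t)) \<partial>pzf_space G)"
    unfolding ept_from_def W_def by (intro nn_integral_mono pt_pzf_le_suminf)
  ultimately show ?thesis
    using meas[OF B(1)] by (simp add: nn_integral_suminf)
qed

text \<open>The counterpart for the lower bound: a potential that gains at most 1 per round in
  expectation cannot be large early.\<close>

lemma nn_integral_pzf_blue_le:
  fixes f :: "'a set \<Rightarrow> ennreal"
  assumes fin: "finite (pverts G)" and B: "B \<subseteq> pverts G" "B \<noteq> {}"
    and drift: "\<And>C. C \<subseteq> pverts G \<Longrightarrow> C \<noteq> {} \<Longrightarrow>
      (\<integral>\<^sup>+ x. f (pzf_round G C x) \<partial>pzf_round_space G) \<le> f C + 1"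
  shows "(\<integral>\<^sup>+ \<omega>. f (pzf_blue G B \<omega> t) \<partial>pzf_space G) \<le> f B + of_nat t"
  using B
proof (induction t arbitrary: B)
  case 0
  show ?case unfolding nn_integral_pzf_blue_0 by simp
next
  case (Suc t)
  have "(\<integral>\<^sup>+ \<omega>. f (pzf_blue G B \<omega> (Suc t)) \<partial>pzf_space G) \<le>
      (\<integral>\<^sup>+ x. f (pzf_round G B x) + of_nat t \<partial>pzf_round_space G)"
    unfolding nn_integral_pzf_blue_Suc[OF fin Suc.prems(1)]
    using Suc.prems pzf_round_superset[of B G]
    by (intro nn_integral_mono Suc.IH pzf_round_subset) blast+
  also have "\<dots> = (\<integral>\<^sup>+ x. f (pzf_round G B x) \<partial>pzf_round_space G) + of_nat t"
    using prob_space.emeasure_space_1[OF prob_space_pzf_round_space, of G]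
      borel_measurable_pzf_round[OF fin Suc.prems(1), of f]
    by (subst nn_integral_add) simp_all
  also have "\<dots> \<le> f B + 1 + of_nat t"
    using drift[OF Suc.prems] by (rule add_right_mono)
  finally show ?case by (simp add: add.assoc)
qed

section \<open>One round on the complete graph\<close>

text \<open>Only finitely many blue sets can occur, so any function of them is bounded.\<close>

lemma integrable_pzf_round:
  fixes f :: "'a set \<Rightarrow> real"
  assumes "finite (pverts G)" "C \<subseteq> pverts G"
  shows "integrable (pzf_round_space G) (\<lambda>x. f (pzf_round G C x))"
proof -
  interpret prob_space "pzf_round_space G" by (rule prob_space_pzf_round_space)
  show ?thesis
  proof (rule integrable_const_bound)
    have "norm (f (pzf_round G C x)) \<le> (\<Sum>D\<in>Pow (pverts G). norm (f D))" for x
      using assms pzf_round_subset[OF assms(2)] by (intro member_le_sum) auto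
    thus "AE x in pzf_round_space G. norm (f (pzf_round G C x)) \<le> (\<Sum>D\<in>Pow (pverts G). norm (f D))"
      by simp
  qed (rule borel_measurable_pzf_round[OF assms])
qed

lemma sets_pzf_round:
  assumes "finite (pverts G)" "C \<subseteq> pverts G"
  shows "{x \<in> space (pzf_round_space G). P (pzf_round G C x)} \<in> sets (pzf_round_space G)"
proof -
  have "pzf_round G C -` {D \<in> Pow (pverts G). P D} \<inter> space (pzf_round_space G) \<in> sets (pzf_round_space G)"
    by (rule measurable_sets[OF measurable_pzf_round[OF assms]]) auto
  also have "pzf_round G C -` {D \<in> Pow (pverts G). P D} \<inter> space (pzf_round_space G) =
      {x \<in> space (pzf_round_space G). P (pzf_round G C x)}"
    using pzf_round_subset[OF assms(2)] by blast
  finally show ?thesis .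
qed

lemma expectation_of_bool_pzf_round:
  assumes "finite (pverts G)" "C \<subseteq> pverts G"
  shows "(\<integral>x. of_bool (P (pzf_round G C x)) \<partial>pzf_round_space G) =
    measure (pzf_round_space G) {x \<in> space (pzf_round_space G). P (pzf_round G C x)}"
proof -
  interpret prob_space "pzf_round_space G" by (rule prob_space_pzf_round_space)
  have "(\<integral>x. of_bool (P (pzf_round G C x)) \<partial>pzf_round_space G) =
      (\<integral>x. indicator {x \<in> space (pzf_round_space G). P (pzf_round G C x)} x \<partial>pzf_round_space G)"
    by (intro Bochner_Integration.integral_cong) (auto simp: indicator_def)
  also have "\<dots> = measure (pzf_round_space G) {x \<in> space (pzf_round_space G). P (pzf_round G C x)}"
    using sets_pzf_round[OF assms, of P] by simp
  finally show ?thesis .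
qed

text \<open>The probability that a fixed white vertex of the complete graph survives a round with
  \<open>k\<close> blue vertices: each of them has degree \<open>n - 1\<close> and all
  \<open>k\<close> blue vertices in its closed neighborhood.\<close>

definition miss_prob :: "nat \<Rightarrow> nat \<Rightarrow> real" where
  "miss_prob n k = (1 - real k / (real n - 1)) ^ k"

lemma psubset_lessThan_card:
  assumes "C \<subset> {..<n}"
  shows "finite C" "card C < n"
  using assms finite_subset[of C "{..<n}"] psubset_card_mono[of "{..<n}" C] by auto

lemma force_prob_complete:
  assumes "C \<subseteq> {..<n}" "u \<in> C"
  shows "force_prob (complete_pair_graph n) C u = real (card C) / (real n - 1)"
proof -
  have nb: "nbhd (complete_pair_graph n) u = {..<n} - {u}"
    using assms by (auto simp: nbhd_def)
  hence "closed_nbhd (complete_pair_graph n) u \<inter> C = C"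
    using assms by (auto simp: closed_nbhd_def)
  moreover have "real (card ({..<n} - {u})) = real n - 1"
    using assms by (subst card_Diff_singleton) auto
  ultimately show ?thesis
    by (simp add: force_prob_def vdegree_def nb)
qed

text \<open>\<open>S\<close> stays white iff all coordinates in \<open>C \<times> S\<close> are at
  least the common success probability \<open>p\<close>; these coordinates are independent, so the
  probability is a power of \<open>1 - p\<close>.\<close>

lemma prob_disjoint_pzf_round_complete:
  assumes C: "C \<subset> {..<n}" and S: "S \<subseteq> {..<n} - C"
  shows "measure (pzf_round_space (complete_pair_graph n))
      {x \<in> space (pzf_round_space (complete_pair_graph n)). S \<inter> pzf_round (complete_pair_graph n) C x = {}}
    = miss_prob n (card C) ^ card S"
proof -
  let ?M = "pzf_round_space (complete_pair_graph n)"
  let ?U = "uniform_measure lborel {0..1::real}"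
  define p where "p = real (card C) / (real n - 1)"
  have p: "0 \<le> p" "p \<le> 1"
    using psubset_lessThan_card[OF C] by (auto simp: p_def divide_le_eq)
  interpret U: prob_space ?U by (rule prob_space_uniform_measure) auto
  interpret product_prob_space "\<lambda>_. ?U" "{..<n} \<times> {..<n}" ..
  have fin: "finite C" "finite S" using C S finite_subset by blast+
  have miss: "w \<notin> pzf_round (complete_pair_graph n) C x \<longleftrightarrow> (\<forall>u\<in>C. p \<le> x (u, w))" if "w \<in> S" for w x
  proof -
    have "(\<exists>u\<in>C. (u, w) \<in> parcs (complete_pair_graph n) \<and>
        x (u, w) < force_prob (complete_pair_graph n) C u) \<longleftrightarrow> (\<exists>u\<in>C. x (u, w) < p)"
      using that C S by (intro bex_cong) (auto simp: force_prob_complete p_def)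
    thus ?thesis
      using that S by (auto simp: pzf_round_def not_less simp del: complete_pair_graph_simps(2))
  qed
  have "{x \<in> space ?M. S \<inter> pzf_round (complete_pair_graph n) C x = {}}
      = {x \<in> space ?M. \<forall>w\<in>S. w \<notin> pzf_round (complete_pair_graph n) C x}"
    by blast
  also have "\<dots> = {x \<in> space ?M. \<forall>e\<in>C \<times> S. x e \<in> {p..}}"
    using miss by auto
  also have "emeasure ?M \<dots> = (\<Prod>e\<in>C \<times> S. emeasure ?U {p..})"
    unfolding pzf_round_space_def complete_pair_graph_simps
    by (rule emeasure_PiM_Collect) (use C S fin in auto)
  also have "emeasure ?U {p..} = ennreal (1 - p)"
  proof -
    have "{0..1} \<inter> {p..} = {p..1}" using p by auto
    thus ?thesis using p by (subst emeasure_uniform_measure) (auto simp: divide_ennreal_def)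
  qed
  also have "(\<Prod>e\<in>C \<times> S. ennreal (1 - p)) = ennreal ((1 - p) ^ (card C * card S))"
    using p by (simp add: card_cartesian_product ennreal_power)
  finally show ?thesis
    using p by (simp add: measure_def miss_prob_def p_def power_mult)
qed

lemma miss_prob_nonneg: "k < n \<Longrightarrow> 0 \<le> miss_prob n k"
  unfolding miss_prob_def by (intro zero_le_power) (auto simp: divide_le_eq)

lemma miss_prob_le_exp:
  assumes "k < n"
  shows "miss_prob n k \<le> exp (- (real k ^ 2 / (real n - 1)))"
proof -
  have "miss_prob n k \<le> exp (- (real k / (real n - 1))) ^ k"
    unfolding miss_prob_def using assms exp_ge_add_one_self[of "- (real k / (real n - 1))"]
    by (intro power_mono) (auto simp: divide_le_eq)
  thus ?thesis by (simp add: exp_of_nat_mult[symmetric] power2_eq_square)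
qed

lemma miss_prob_ge:
  assumes "k < n"
  shows "1 - real k ^ 2 / (real n - 1) \<le> miss_prob n k"
  using Bernoulli_inequality[of "- (real k / (real n - 1))" k] assms
  by (simp add: miss_prob_def power2_eq_square divide_le_eq)

text \<open>With \<open>y = k^2 / (n - 1)\<close> this is
  \<open>1 - exp (- y) \<ge> y / (1 + y)\<close>. The form is of order \<open>min y 1\<close>, and
  so serves both for \<open>k^2 < n\<close> and for \<open>k^2 \<ge> n\<close>.\<close>

lemma one_minus_miss_prob_ge:
  assumes "k < n" "0 < k"
  shows "real k ^ 2 / (real n - 1 + real k ^ 2) \<le> 1 - miss_prob n k"
proof -
  define y where "y = real k ^ 2 / (real n - 1)"
  have y: "y > 0" using assms by (auto simp: y_def)
  have "miss_prob n k \<le> exp (- y)" using miss_prob_le_exp[OF assms(1)] by (simp add: y_def)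
  also have "\<dots> \<le> 1 / (1 + y)"
    using exp_ge_add_one_self[of y] y by (simp add: exp_minus field_simps)
  finally have "1 - 1 / (1 + y) \<le> 1 - miss_prob n k" by simp
  moreover have "1 - 1 / (1 + y) = real k ^ 2 / (real n - 1 + real k ^ 2)"
  proof -
    have "real n - 1 > 0" "real n - 1 + real k ^ 2 > 0"
      using assms by (auto intro: add_pos_pos)
    thus ?thesis by (simp add: y_def field_simps)
  qed
  ultimately show ?thesis by simp
qed

text \<open>Linearity of expectation, with the set probability applied to singletons.\<close>

lemma expectation_card_white_complete:
  assumes C: "C \<subset> {..<n}"
  shows "(\<integral>x. real (card ({..<n} - pzf_round (complete_pair_graph n) C x))
      \<partial>pzf_round_space (complete_pair_graph n)) = real (n - card C) * miss_prob n (card C)"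
proof -
  let ?G = "complete_pair_graph n"
  have C': "C \<subseteq> pverts ?G" using C by auto
  have fin: "finite (pverts ?G)" by simp
  have "real (card ({..<n} - pzf_round ?G C x)) = (\<Sum>w\<in>{..<n} - C. of_bool ({w} \<inter> pzf_round ?G C x = {}))" for x
  proof -
    have "{..<n} - pzf_round ?G C x = {w \<in> {..<n} - C. w \<notin> pzf_round ?G C x}"
      using pzf_round_superset[of C ?G x] by auto
    thus ?thesis by (simp add: sum_of_bool_eq Int_def)
  qed
  hence "(\<integral>x. real (card ({..<n} - pzf_round ?G C x)) \<partial>pzf_round_space ?G) =
      (\<integral>x. (\<Sum>w\<in>{..<n} - C. of_bool ({w} \<inter> pzf_round ?G C x = {})) \<partial>pzf_round_space ?G)"
    by (simp only:)
  also have "\<dots> = (\<Sum>w\<in>{..<n} - C. \<integral>x. of_bool ({w} \<inter> pzf_round ?G C x = {}) \<partial>pzf_round_space ?G)"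
    by (intro Bochner_Integration.integral_sum integrable_pzf_round[OF fin C'])
  also have "\<dots> = (\<Sum>w\<in>{..<n} - C. miss_prob n (card C))"
  proof (intro sum.cong refl)
    fix w assume "w \<in> {..<n} - C"
    thus "(\<integral>x. of_bool ({w} \<inter> pzf_round ?G C x = {}) \<partial>pzf_round_space ?G) = miss_prob n (card C)"
      using prob_disjoint_pzf_round_complete[OF C, of "{w}"]
        expectation_of_bool_pzf_round[OF fin C', of "\<lambda>D. {w} \<inter> D = {}"]
      by simp
  qed
  also have "\<dots> = real (n - card C) * miss_prob n (card C)"
    using C psubset_lessThan_card[OF C] by (simp add: card_Diff_subset)
  finally show ?thesis .
qed

text \<open>Since $2^{|U|}$ counts the subsets of \<open>U\<close>, this moment needs only the probabilities that
  a given set stays white.\<close>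

lemma expectation_two_power_white_complete:
  assumes C: "C \<subset> {..<n}"
  shows "(\<integral>x. (2::real) ^ card ({..<n} - pzf_round (complete_pair_graph n) C x)
      \<partial>pzf_round_space (complete_pair_graph n)) = (1 + miss_prob n (card C)) ^ (n - card C)"
proof -
  let ?G = "complete_pair_graph n" and ?r = "miss_prob n (card C)"
  have C': "C \<subseteq> pverts ?G" using C by auto
  have fin: "finite (pverts ?G)" by simp
  have "(2::real) ^ card ({..<n} - pzf_round ?G C x) =
      (\<Sum>S\<in>Pow ({..<n} - C). of_bool (S \<inter> pzf_round ?G C x = {}))" for x
  proof -
    have "(2::real) ^ card ({..<n} - pzf_round ?G C x) = real (card (Pow ({..<n} - pzf_round ?G C x)))"
      by (simp add: card_Pow)
    also have "Pow ({..<n} - pzf_round ?G C x) = {S \<in> Pow ({..<n} - C). S \<inter> pzf_round ?G C x = {}}"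
      using pzf_round_superset[of C ?G x] by auto
    also have "real (card \<dots>) = (\<Sum>S\<in>Pow ({..<n} - C). of_bool (S \<inter> pzf_round ?G C x = {}))"
      by (simp add: sum_of_bool_eq Int_def)
    finally show ?thesis .
  qed
  hence "(\<integral>x. (2::real) ^ card ({..<n} - pzf_round ?G C x) \<partial>pzf_round_space ?G) =
      (\<integral>x. (\<Sum>S\<in>Pow ({..<n} - C). of_bool (S \<inter> pzf_round ?G C x = {})) \<partial>pzf_round_space ?G)"
    by (simp only:)
  also have "\<dots> = (\<Sum>S\<in>Pow ({..<n} - C). \<integral>x. of_bool (S \<inter> pzf_round ?G C x = {}) \<partial>pzf_round_space ?G)"
    by (intro Bochner_Integration.integral_sum integrable_pzf_round[OF fin C'])
  also have "\<dots> = (\<Sum>S\<in>Pow ({..<n} - C). ?r ^ card S)"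
    using prob_disjoint_pzf_round_complete[OF C]
    by (intro sum.cong refl) (subst expectation_of_bool_pzf_round[OF fin C'], simp)
  \<comment> \<open>Choosing \<open>?r\<close> or 1 in each factor of the product is choosing a
    subset \<open>S\<close>.\<close>
  also have "\<dots> = (1 + ?r) ^ (n - card C)"
    using prod_add[of "{..<n} - C" "\<lambda>_. ?r" "\<lambda>_. 1"] C psubset_lessThan_card[OF C]
    by (simp add: card_Diff_subset add.commute)
  finally show ?thesis .
qed

text \<open>A Chernoff bound for the lower tail, where \<open>\<mu>\<close> is any lower bound for
  the expected number of new blue vertices. Too few new ones means many white ones, and Markov's
  inequality is applied to 2 to the number of white vertices. The moment contributes at most
  \<open>exp (- (\<mu> / 2))\<close>, and the allowed deficit costs a factor
  \<open>2 powr (\<mu> / 4) \<le> exp (\<mu> / 4)\<close>.\<close>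

lemma prob_growth_complete:
  assumes C: "C \<subset> {..<n}" and mu: "0 \<le> \<mu>" "\<mu> \<le> real (n - card C) * (1 - miss_prob n (card C))"
  shows "measure (pzf_round_space (complete_pair_graph n))
      {x \<in> space (pzf_round_space (complete_pair_graph n)).
        \<not> real (card C) + \<mu> / 4 \<le> real (card (pzf_round (complete_pair_graph n) C x))} \<le> exp (- (\<mu> / 4))"
proof -
  let ?G = "complete_pair_graph n" and ?r = "miss_prob n (card C)" and ?N = "n - card C"
  let ?M = "pzf_round_space ?G"
  have C': "C \<subseteq> pverts ?G" using C by auto
  have fin: "finite (pverts ?G)" by simp
  have k: "card C < n" using psubset_lessThan_card[OF C] by simp
  interpret prob_space ?M by (rule prob_space_pzf_round_space)
  \<comment> \<open>Fewer than \<open>\<mu> / 4\<close> new blue vertices leave more than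
    \<open>?N - \<mu> / 4\<close> white ones; this exponent need not be an integer, hence
    \<open>powr\<close>.\<close>
  define a where "a = 2 powr (real ?N - \<mu> / 4)"
  have "{x \<in> space ?M. \<not> real (card C) + \<mu> / 4 \<le> real (card (pzf_round ?G C x))}
      \<subseteq> {x \<in> space ?M. 2 ^ card ({..<n} - pzf_round ?G C x) \<ge> a}"
  proof safe
    fix x assume x: "\<not> real (card C) + \<mu> / 4 \<le> real (card (pzf_round ?G C x))"
    have sub: "pzf_round ?G C x \<subseteq> {..<n}" using pzf_round_subset[OF C'] by simp
    hence "card ({..<n} - pzf_round ?G C x) = n - card (pzf_round ?G C x)"
      by (simp add: card_Diff_subset finite_subset)
    moreover have "card (pzf_round ?G C x) \<le> n"
      using card_mono[OF _ sub] by simp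
    ultimately have "real ?N - \<mu> / 4 \<le> real (card ({..<n} - pzf_round ?G C x))"
      using x k by simp
    hence "a \<le> 2 powr real (card ({..<n} - pzf_round ?G C x))"
      unfolding a_def by (intro powr_mono) auto
    thus "a \<le> 2 ^ card ({..<n} - pzf_round ?G C x)"
      by (simp add: powr_realpow)
  qed
  hence "measure ?M {x \<in> space ?M. \<not> real (card C) + \<mu> / 4 \<le> real (card (pzf_round ?G C x))}
      \<le> measure ?M {x \<in> space ?M. 2 ^ card ({..<n} - pzf_round ?G C x) \<ge> a}"
    by (intro finite_measure_mono sets_pzf_round[OF fin C'])
  also have "\<dots> \<le> (\<integral>x. 2 ^ card ({..<n} - pzf_round ?G C x) \<partial>?M) / a"
    by (intro integral_Markov_inequality_measure[where A = "{}"] integrable_pzf_round[OF fin C'])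
      (auto simp: a_def)
  also have "\<dots> = (1 + ?r) ^ ?N / a"
    by (simp add: expectation_two_power_white_complete[OF C])
  also have "\<dots> = ((1 + ?r) / 2) ^ ?N * 2 powr (\<mu> / 4)"
    by (simp add: a_def powr_diff powr_realpow power_divide)
  also have "(1 + ?r) / 2 = 1 - (1 - ?r) / 2"
    by (simp add: field_simps)
  also have "(1 - (1 - ?r) / 2) ^ ?N * 2 powr (\<mu> / 4) \<le> exp (- (\<mu> / 2)) * exp (\<mu> / 4)"
  proof (intro mult_mono)
    have "(1 - (1 - ?r) / 2) ^ ?N \<le> exp (- ((1 - ?r) / 2)) ^ ?N"
      using exp_ge_add_one_self[of "- ((1 - ?r) / 2)"] miss_prob_nonneg[OF k]
      by (intro power_mono) auto
    also have "\<dots> = exp (- (real ?N * (1 - ?r) / 2))"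
      by (simp add: exp_of_nat_mult[symmetric])
    also have "\<dots> \<le> exp (- (\<mu> / 2))"
      using mu by simp
    finally show "(1 - (1 - ?r) / 2) ^ ?N \<le> exp (- (\<mu> / 2))" .
  next
    show "2 powr (\<mu> / 4) \<le> exp (\<mu> / 4)"
      using mu(1) ln_le_minus_one[of 2] by (simp add: powr_def mult_left_le)
  qed auto
  also have "\<dots> = exp (- (\<mu> / 4))"
    by (simp add: exp_add[symmetric])
  finally show ?thesis .
qed

text \<open>First-moment bound: an unfinished round leaves at least one white vertex.\<close>

lemma prob_unfinished_complete:
  assumes C: "C \<subset> {..<n}"
  shows "measure (pzf_round_space (complete_pair_graph n))
      {x \<in> space (pzf_round_space (complete_pair_graph n)).
        pzf_round (complete_pair_graph n) C x \<noteq> {..<n}} \<le> real n * miss_prob n (card C)"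
proof -
  let ?G = "complete_pair_graph n"
  let ?M = "pzf_round_space ?G"
  have C': "C \<subseteq> pverts ?G" using C by auto
  have fin: "finite (pverts ?G)" by simp
  interpret prob_space ?M by (rule prob_space_pzf_round_space)
  have "measure ?M {x \<in> space ?M. pzf_round ?G C x \<noteq> {..<n}}
      = (\<integral>x. of_bool (pzf_round ?G C x \<noteq> {..<n}) \<partial>?M)"
    by (rule expectation_of_bool_pzf_round[OF fin C', symmetric])
  also have "\<dots> \<le> (\<integral>x. real (card ({..<n} - pzf_round ?G C x)) \<partial>?M)"
  proof (intro integral_mono integrable_pzf_round[OF fin C'])
    fix x
    have "pzf_round ?G C x \<subseteq> {..<n}" using pzf_round_subset[OF C'] by simp
    hence "pzf_round ?G C x \<noteq> {..<n} \<Longrightarrow> 0 < card ({..<n} - pzf_round ?G C x)"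
      by (subst card_gt_0_iff) auto
    thus "of_bool (pzf_round ?G C x \<noteq> {..<n}) \<le> real (card ({..<n} - pzf_round ?G C x))"
      by (cases "pzf_round ?G C x = {..<n}") auto
  qed
  also have "\<dots> = real (n - card C) * miss_prob n (card C)"
    by (rule expectation_card_white_complete[OF C])
  also have "\<dots> \<le> real n * miss_prob n (card C)"
    using psubset_lessThan_card[OF C] by (intro mult_right_mono miss_prob_nonneg) auto
  finally show ?thesis .
qed

text \<open>By Bernoulli's inequality a white vertex is forced with probability at most
  \<open>k^2 / (n - 1)\<close>, and there are at most \<open>n - 1\<close> white vertices; finally
  \<open>k \<le> k^2\<close>.\<close>

lemma expectation_card_pzf_round_complete_le:
  assumes C: "C \<subset> {..<n}" "C \<noteq> {}"
  shows "(\<integral>x. real (card (pzf_round (complete_pair_graph n) C x))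
      \<partial>pzf_round_space (complete_pair_graph n)) \<le> 2 * real (card C) ^ 2"
proof -
  let ?G = "complete_pair_graph n" and ?k = "card C"
  let ?M = "pzf_round_space ?G"
  have C': "C \<subseteq> pverts ?G" using C by auto
  have fin: "finite (pverts ?G)" by simp
  have k: "?k < n" "0 < ?k" using psubset_lessThan_card[OF C(1)] C(2) by (auto simp: card_gt_0_iff)
  interpret prob_space ?M by (rule prob_space_pzf_round_space)
  have "real (card (pzf_round ?G C x)) = real n - real (card ({..<n} - pzf_round ?G C x))" for x
  proof -
    have "pzf_round ?G C x \<subseteq> {..<n}" using pzf_round_subset[OF C'] by simp
    thus ?thesis using card_mono[of "{..<n}" "pzf_round ?G C x"]
      by (simp add: card_Diff_subset finite_subset)
  qed
  hence "(\<integral>x. real (card (pzf_round ?G C x)) \<partial>?M) =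
      (\<integral>x. real n - real (card ({..<n} - pzf_round ?G C x)) \<partial>?M)"
    by simp
  also have "\<dots> = real n - real (n - ?k) * miss_prob n ?k"
    by (subst Bochner_Integration.integral_diff)
      (auto simp: expectation_card_white_complete[OF C(1)] prob_space intro: integrable_pzf_round[OF fin C'])
  also have "\<dots> \<le> real n - real (n - ?k) * (1 - real ?k ^ 2 / (real n - 1))"
    using miss_prob_ge[OF k(1)] by (intro diff_left_mono mult_left_mono) auto
  also have "\<dots> = real ?k + real (n - ?k) * (real ?k ^ 2 / (real n - 1))"
    using k by (simp add: algebra_simps)
  also have "\<dots> \<le> real ?k ^ 2 + (real n - 1) * (real ?k ^ 2 / (real n - 1))"
    using k by (intro add_mono mult_right_mono) (auto simp: power2_eq_square)
  also have "\<dots> = 2 * real ?k ^ 2" using k by simp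
  finally show ?thesis .
qed

section \<open>The iterated logarithm and the two bounds\<close>

text \<open>The added 1 makes the function nonnegative on all \<open>x \<ge> 1\<close> and 0 at the
  initial value 1, where \<open>ln (ln x)\<close> would be meaningless.\<close>

definition loglog :: "real \<Rightarrow> real" where
  "loglog x = ln (1 + ln x)"

lemma loglog_nonneg: "1 \<le> x \<Longrightarrow> 0 \<le> loglog x"
  by (simp add: loglog_def)

lemma loglog_mono:
  assumes "1 \<le> x" "x \<le> y"
  shows "loglog x \<le> loglog y"
proof -
  have "0 \<le> ln x" "ln x \<le> ln y" using assms by simp_all
  thus ?thesis unfolding loglog_def by (subst ln_le_cancel_iff) linarith+
qed

text \<open>Concavity as a tangent-line bound, which can be integrated directly in place of Jensen's
  inequality. The slope is the derivative at \<open>a\<close>.\<close>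

lemma loglog_le_tangent:
  assumes "1 \<le> x" "1 \<le> a"
  shows "loglog x \<le> loglog a + (x - a) * (1 / (a * (1 + ln a)))"
proof -
  have pos: "1 + ln x > 0" "1 + ln a > 0" using assms by (simp_all add: add_pos_nonneg)
  have "loglog x - loglog a \<le> (ln x - ln a) / (1 + ln a)"
    using ln_diff_le[OF pos] by (simp add: loglog_def)
  also have "\<dots> \<le> ((x - a) / a) / (1 + ln a)"
    using ln_diff_le[of x a] assms pos by (intro divide_right_mono) auto
  finally show ?thesis by simp
qed

text \<open>Passing from \<open>x\<close> to \<open>2 * x ^ 2\<close> at most doubles
  \<open>1 + ln x\<close>, which adds at most \<open>ln 2\<close> after the outer logarithm.\<close>

lemma loglog_double_square_le:
  assumes "1 \<le> x"
  shows "loglog (2 * x ^ 2) \<le> loglog x + 1"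
proof -
  have pos: "1 + ln x > 0" using assms by (simp add: add_pos_nonneg)
  have "ln (2 * x ^ 2) = ln 2 + 2 * ln x"
    using assms by (simp add: ln_mult ln_realpow)
  also have "\<dots> \<le> 1 + 2 * ln x"
    using ln_le_minus_one[of 2] by simp
  finally have "1 + ln (2 * x ^ 2) \<le> 2 * (1 + ln x)" by simp
  moreover have "1 \<le> 2 * x ^ 2"
    using assms one_le_power[of x 2] by linarith
  hence "0 < 1 + ln (2 * x ^ 2)" by (simp add: add_pos_nonneg)
  ultimately have "loglog (2 * x ^ 2) \<le> ln (2 * (1 + ln x))"
    unfolding loglog_def using pos by simp
  also have "\<dots> = ln 2 + loglog x"
    unfolding loglog_def using pos by (subst ln_mult) auto
  finally show ?thesis using ln_le_minus_one[of 2] by simp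
qed

text \<open>The gain must be uniform down to \<open>x = 1\<close>, where the factor
  \<open>1 + x / 16\<close> is close to 1. Bernoulli gives
  \<open>ln (1 + x / 16) \<ge> ln (1 + x) / 16\<close>, and
  \<open>1 + ln x \<le> 3 * ln (1 + x)\<close>; so \<open>1 + ln x\<close> grows by a factor of at
  least 49/48, whose logarithm is at least 1/49.\<close>

lemma loglog_growth:
  assumes "1 \<le> x"
  shows "loglog x + 1 / 49 \<le> loglog (x + x ^ 2 / 16)"
proof -
  have lnx: "0 \<le> ln x" using assms by simp
  have "1 + x \<le> (1 + x / 16) ^ 16"
    using Bernoulli_inequality[of "x / 16" 16] assms by simp
  hence "ln (1 + x) \<le> ln ((1 + x / 16) ^ 16)"
    using assms by (subst ln_le_cancel_iff) auto
  also have "\<dots> = 16 * ln (1 + x / 16)"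
    using assms by (subst ln_realpow) auto
  finally have 1: "ln (1 + x) \<le> 16 * ln (1 + x / 16)" .
  have "1 / 2 \<le> ln (2 :: real)"
    using ln_one_minus_pos_upper_bound[of "1/2"] by (simp add: ln_div)
  also have "\<dots> \<le> ln (1 + x)" using assms by simp
  finally have 2: "1 / 2 \<le> ln (1 + x)" .
  have 3: "ln x \<le> ln (1 + x)" using assms by simp
  have "ln (x + x ^ 2 / 16) = ln (x * (1 + x / 16))"
    by (simp add: algebra_simps power2_eq_square)
  also have "\<dots> = ln x + ln (1 + x / 16)"
    using assms by (subst ln_mult) auto
  also have "\<dots> \<ge> ln x + (1 + ln x) / 48"
    using 1 2 3 by (intro add_left_mono) simp
  finally have "(49 / 48) * (1 + ln x) \<le> 1 + ln (x + x ^ 2 / 16)" by (simp add: field_simps)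
  hence "ln ((49 / 48) * (1 + ln x)) \<le> loglog (x + x ^ 2 / 16)"
    unfolding loglog_def using lnx by (subst ln_le_cancel_iff) auto
  moreover have "ln ((49 / 48) * (1 + ln x)) = ln (49 / 48) + loglog x"
    unfolding loglog_def using lnx by (subst ln_mult) auto
  moreover have "1 / 49 \<le> ln (49 / 48 :: real)"
    using ln_le_minus_one[of "48 / 49"] by (simp add: ln_div)
  ultimately show ?thesis by linarith
qed

lemma card_pzf_round_bounds:
  assumes "C \<subseteq> {..<n}"
  shows "card C \<le> card (pzf_round (complete_pair_graph n) C x)"
    "card (pzf_round (complete_pair_graph n) C x) \<le> n"
proof -
  have sub: "pzf_round (complete_pair_graph n) C x \<subseteq> {..<n}"
    using assms pzf_round_subset[of C "complete_pair_graph n"] by simp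
  thus "card (pzf_round (complete_pair_graph n) C x) \<le> n"
    using card_mono[OF _ sub] by simp
  show "card C \<le> card (pzf_round (complete_pair_graph n) C x)"
    using sub by (intro card_mono pzf_round_superset) (auto intro: finite_subset)
qed

lemma nn_integral_loglog_pzf_round_le:
  assumes C: "C \<subseteq> {..<n}" "C \<noteq> {}"
  shows "(\<integral>\<^sup>+ x. ennreal (loglog (card (pzf_round (complete_pair_graph n) C x)))
      \<partial>pzf_round_space (complete_pair_graph n)) \<le> ennreal (loglog (card C)) + 1"
proof (cases "C = {..<n}")
  case True
  have "pzf_round (complete_pair_graph n) C x = C" for x
    using pzf_round_pverts[of "complete_pair_graph n" x] True by simp
  thus ?thesis
    using prob_space.emeasure_space_1[OF prob_space_pzf_round_space, of "complete_pair_graph n"] by simp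
next
  case False
  let ?G = "complete_pair_graph n" and ?k = "card C"
  let ?M = "pzf_round_space ?G"
  have C': "C \<subseteq> pverts ?G" using C by auto
  have fin: "finite (pverts ?G)" by simp
  have C'': "C \<subset> {..<n}" using C False by auto
  have k: "1 \<le> ?k" using C finite_subset[of C "{..<n}"] by (simp add: Suc_le_eq card_gt_0_iff)
  interpret prob_space ?M by (rule prob_space_pzf_round_space)
  \<comment> \<open>The tangent is taken at the upper bound for the mean, so its linear term has
    nonpositive expectation.\<close>
  define a where "a = 2 * real ?k ^ 2"
  define s where "s = 1 / (a * (1 + ln a))"
  have a: "1 \<le> a" using k one_le_power[of "real ?k" 2] unfolding a_def by linarith
  have s: "0 \<le> s" using a by (simp add: s_def)
  have "(\<integral>x. loglog (card (pzf_round ?G C x)) \<partial>?M) \<le>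
      (\<integral>x. loglog a + (real (card (pzf_round ?G C x)) - a) * s \<partial>?M)"
  proof (intro integral_mono integrable_pzf_round[OF fin C'])
    fix x
    show "loglog (card (pzf_round ?G C x)) \<le> loglog a + (real (card (pzf_round ?G C x)) - a) * s"
      unfolding s_def using card_pzf_round_bounds(1)[OF C(1), of x] k a
      by (intro loglog_le_tangent) auto
  qed
  also have "\<dots> = loglog a + ((\<integral>x. real (card (pzf_round ?G C x)) \<partial>?M) - a) * s"
    using integrable_pzf_round[OF fin C', of "\<lambda>D. real (card D)"] by (simp add: prob_space)
  also have "\<dots> \<le> loglog a"
    using expectation_card_pzf_round_complete_le[OF C'' C(2)] s
    by (simp add: a_def mult_nonpos_nonneg)
  also have "\<dots> \<le> loglog ?k + 1"
    using loglog_double_square_le[of "real ?k"] k by (simp add: a_def)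
  finally have "(\<integral>x. loglog (card (pzf_round ?G C x)) \<partial>?M) \<le> loglog ?k + 1" .
  moreover have "(\<integral>\<^sup>+ x. ennreal (loglog (card (pzf_round ?G C x))) \<partial>?M) =
      ennreal (\<integral>x. loglog (card (pzf_round ?G C x)) \<partial>?M)"
  proof (intro nn_integral_eq_integral integrable_pzf_round[OF fin C'] AE_I2)
    fix x
    show "0 \<le> loglog (card (pzf_round ?G C x))"
      using card_pzf_round_bounds(1)[OF C(1), of x] k by (intro loglog_nonneg) simp
  qed
  ultimately have "(\<integral>\<^sup>+ x. ennreal (loglog (card (pzf_round ?G C x))) \<partial>?M) \<le> ennreal (loglog ?k + 1)"
    by (simp add: ennreal_leI)
  thus ?thesis using k by (simp add: ennreal_plus loglog_nonneg)
qed

lemma ept_from_complete_ge: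
  assumes v: "v < n" and n: "2 \<le> n"
  shows "ennreal (loglog n / 4) \<le> ept_from (complete_pair_graph n) {v}"
proof -
  let ?G = "complete_pair_graph n"
  let ?M = "pzf_space ?G"
  have fin: "finite (pverts ?G)" by simp
  have v': "{v} \<subseteq> pverts ?G" using v by simp
  interpret prob_space ?M by (rule prob_space_pzf_space)
  have "0 < ln (real n)" using n by simp
  hence pos: "0 < loglog n"
    unfolding loglog_def by (intro ln_gt_zero) simp
  \<comment> \<open>The potential starts at \<open>loglog 1 = 0\<close>, so Markov leaves a white
    vertex after \<open>t\<close> rounds with probability at least 1/2. The propagation time is then
    at least \<open>Suc t\<close>, which undoes the rounding down, also when
    \<open>t = 0\<close>.\<close>
  define t where "t = nat \<lfloor>loglog n / 2\<rfloor>"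
  have t: "real t \<le> loglog n / 2" "loglog n / 2 \<le> real (Suc t)"
    using pos by (simp_all add: t_def) linarith+
  define A where "A = {\<omega> \<in> space ?M. pzf_blue ?G {v} \<omega> t = {..<n}}"
  have A: "A \<in> sets ?M"
    unfolding A_def
    using measurable_sets[OF measurable_pzf_blue[OF fin v', of t], of "{{..<n}}"]
    by (simp add: vimage_def Int_def conj_commute)
  have "ennreal (loglog n) * emeasure ?M A = (\<integral>\<^sup>+ \<omega>. ennreal (loglog n) * indicator A \<omega> \<partial>?M)"
    using A by (simp add: nn_integral_cmult_indicator)
  also have "\<dots> \<le> (\<integral>\<^sup>+ \<omega>. ennreal (loglog (card (pzf_blue ?G {v} \<omega> t))) \<partial>?M)"
    by (intro nn_integral_mono) (auto simp: indicator_def A_def)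
  also have "\<dots> \<le> ennreal (loglog (card {v})) + of_nat t"
    using v nn_integral_loglog_pzf_round_le[of _ n]
    by (intro nn_integral_pzf_blue_le[where f = "\<lambda>D. ennreal (loglog (card D))"]) auto
  also have "\<dots> = ennreal (real t)"
    by (simp add: loglog_def ennreal_of_nat_eq_real_of_nat)
  finally have "ennreal (loglog n * prob A) \<le> ennreal (real t)"
    using pos by (simp add: emeasure_eq_measure ennreal_mult)
  hence "loglog n * prob A \<le> real t" by simp
  also have "\<dots> \<le> loglog n * (1 / 2)" using t by simp
  finally have "prob A \<le> 1 / 2" using pos by (simp only: mult_le_cancel_left_pos)
  hence "loglog n / 4 \<le> real (Suc t) * prob (space ?M - A)"
    using mult_mono[of "loglog n / 2" "real (Suc t)" "1/2" "prob (space ?M - A)"] t pos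
    by (simp add: prob_compl[OF A])
  hence "ennreal (loglog n / 4) \<le> ennreal (real (Suc t)) * emeasure ?M (space ?M - A)"
    by (simp add: emeasure_eq_measure ennreal_mult[symmetric] ennreal_leI del: of_nat_Suc)
  also have "\<dots> = (\<integral>\<^sup>+ \<omega>. of_nat (Suc t) * indicator (space ?M - A) \<omega> \<partial>?M)"
    using A by (subst nn_integral_cmult_indicator) (auto simp: ennreal_of_nat_eq_real_of_nat)
  also have "\<dots> \<le> ept_from ?G {v}"
    unfolding ept_from_def
  proof (intro nn_integral_mono)
    fix \<omega> assume "\<omega> \<in> space ?M"
    thus "of_nat (Suc t) * indicator (space ?M - A) \<omega> \<le> pt_pzf ?G {v} \<omega>"
      using Suc_le_pt_pzf[of ?G "{v}" \<omega> t] by (auto simp: indicator_def A_def)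
  qed
  finally show ?thesis .
qed

text \<open>The thresholds are the square root of \<open>n\<close>, then \<open>n / 8\<close>, then
  \<open>n\<close>. Each later phase is worth 1/49, the gain that \<open>loglog_growth\<close>
  guarantees for a good early round, so that success counts equally in all phases.\<close>

definition stage :: "nat \<Rightarrow> nat \<Rightarrow> real" where
  "stage n k =
     (if n \<le> k then loglog n + 3 / 49
      else if n \<le> 8 * k then loglog n + 2 / 49
      else if n \<le> k ^ 2 then loglog n + 1 / 49
      else loglog k)"

text \<open>Blue sets only grow, so by monotonicity even a bad round never loses potential.\<close>

lemma stage_mono:
  assumes "1 \<le> j" "j \<le> k"
  shows "stage n j \<le> stage n k"
proof -
  have "n \<le> j ^ 2 \<Longrightarrow> n \<le> k ^ 2"
    using power_mono[OF assms(2), of 2] by linarith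
  moreover have "loglog j \<le> loglog k" using assms by (intro loglog_mono) auto
  moreover have "j \<le> n \<Longrightarrow> loglog j \<le> loglog n" using assms by (intro loglog_mono) auto
  ultimately show ?thesis using assms unfolding stage_def by auto
qed

lemma stage_le: "1 \<le> k \<Longrightarrow> stage n k \<le> loglog n + 3 / 49"
  using stage_mono[of k "max k n" n] by (simp add: stage_def[of n "max k n"])

text \<open>In each phase a good event gains 1/49. In the first two phases it fails with probability
  at most \<open>exp (- (1 / 16)) \<le> 1 / (1 + 1 / 16) = 16 / 17\<close>; assumption
  \<open>n\<close> provides the same bound for the last phase.\<close>

lemma prob_stage_stuck:
  assumes C: "C \<subset> {..<n}" "C \<noteq> {}" and n: "real n * exp (- (real n / 64)) \<le> 16 / 17"
  shows "measure (pzf_round_space (complete_pair_graph n))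
      {x \<in> space (pzf_round_space (complete_pair_graph n)).
        \<not> stage n (card C) + 1 / 49 \<le> stage n (card (pzf_round (complete_pair_graph n) C x))} \<le> 16 / 17"
    (is "measure ?M {x \<in> space ?M. \<not> ?good x} \<le> _")
proof -
  let ?G = "complete_pair_graph n" and ?k = "card C"
  have C': "C \<subseteq> pverts ?G" using C by auto
  have fin: "finite (pverts ?G)" by simp
  have k: "?k < n" "1 \<le> ?k"
    using psubset_lessThan_card[OF C(1)] C(2) by (auto simp: Suc_le_eq card_gt_0_iff)
  interpret prob_space ?M by (rule prob_space_pzf_round_space)
  have bound: "measure ?M {x \<in> space ?M. \<not> ?good x} \<le> 16 / 17"
    if "\<And>x. P (pzf_round ?G C x) \<Longrightarrow> ?good x"
      "measure ?M {x \<in> space ?M. \<not> P (pzf_round ?G C x)} \<le> 16 / 17" for P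
  proof -
    have "measure ?M {x \<in> space ?M. \<not> ?good x} \<le> measure ?M {x \<in> space ?M. \<not> P (pzf_round ?G C x)}"
      using that(1) by (intro finite_measure_mono sets_pzf_round[OF fin C']) auto
    with that(2) show ?thesis by simp
  qed
  have ge: "1 - miss_prob n ?k \<ge> real ?k ^ 2 / (real n - 1 + real ?k ^ 2)"
    using one_minus_miss_prob_ge k by simp
  have denom: "0 < real n - 1 + real ?k ^ 2" using k by (intro add_pos_pos) auto
  have white: "real (n - ?k) = real n - real ?k" using k by simp
  consider (finish) "n \<le> 8 * ?k" | (middle) "8 * ?k < n" "n \<le> ?k ^ 2" | (early) "8 * ?k < n" "?k ^ 2 < n"
    by linarith
  thus ?thesis
  proof cases
    case finish
    show ?thesis
    proof (rule bound[of "\<lambda>D. D = {..<n}"])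
      show "?good x" if "pzf_round ?G C x = {..<n}" for x
        unfolding that using finish k by (simp add: stage_def)
      \<comment> \<open>At least \<open>n / 8\<close> blue vertices make the exponent in
        \<open>miss_prob_le_exp\<close> at least \<open>n / 64\<close>.\<close>
      have "(real n / 64) * (real n - 1) \<le> (real n / 8) ^ 2"
        by (simp add: power2_eq_square field_simps)
      also have "\<dots> \<le> real ?k ^ 2"
        using finish by (intro power_mono) auto
      finally have "real n / 64 \<le> real ?k ^ 2 / (real n - 1)"
        using k by (simp add: pos_le_divide_eq)
      hence "miss_prob n ?k \<le> exp (- (real n / 64))"
        using miss_prob_le_exp[OF k(1)] by (meson exp_le_cancel_iff neg_le_iff_le order_trans)
      hence "real n * miss_prob n ?k \<le> real n * exp (- (real n / 64))"
        by (intro mult_left_mono) auto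
      thus "measure ?M {x \<in> space ?M. pzf_round ?G C x \<noteq> {..<n}} \<le> 16 / 17"
        using prob_unfinished_complete[OF C(1)] n by linarith
    qed
  next
    case middle
    \<comment> \<open>From \<open>k^2 \<ge> n\<close> each white vertex is forced with probability
      at least 1/2. A quarter of this mean already suffices, as
      \<open>k + (n - k) / 8 \<ge> n / 8\<close>.\<close>
    define \<mu> where "\<mu> = real (n - ?k) / 2"
    have "real n \<le> real ?k ^ 2" using middle(2) by (metis of_nat_le_iff of_nat_power)
    moreover have "1 / 2 \<le> q / (m - 1 + q)" if "m \<le> q" "0 < m - 1 + q" for m q :: real
      using that by (simp add: pos_le_divide_eq)
    ultimately have "1 / 2 \<le> real ?k ^ 2 / (real n - 1 + real ?k ^ 2)"
      using denom by blast
    hence "1 / 2 \<le> 1 - miss_prob n ?k" using ge by linarith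
    hence "real (n - ?k) * (1 / 2) \<le> real (n - ?k) * (1 - miss_prob n ?k)"
      by (intro mult_left_mono) auto
    hence mu: "\<mu> \<le> real (n - ?k) * (1 - miss_prob n ?k)" by (simp add: \<mu>_def)
    show ?thesis
    proof (rule bound[of "\<lambda>D. real ?k + \<mu> / 4 \<le> real (card D)"])
      show "?good x" if "real ?k + \<mu> / 4 \<le> real (card (pzf_round ?G C x))" for x
      proof -
        have "real n \<le> 8 * real (card (pzf_round ?G C x))"
          using that k white unfolding \<mu>_def by linarith
        hence "n \<le> 8 * card (pzf_round ?G C x)" by linarith
        thus ?thesis using middle k by (auto simp: stage_def)
      qed
      have "measure ?M {x \<in> space ?M. \<not> real ?k + \<mu> / 4 \<le> real (card (pzf_round ?G C x))} \<le> exp (- (\<mu> / 4))"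
        by (rule prob_growth_complete[OF C(1) _ mu]) (simp add: \<mu>_def)
      also have "\<dots> \<le> exp (- (1 / 16))"
        using k by (simp add: \<mu>_def)
      also have "\<dots> \<le> 16 / 17"
        using exp_ge_add_one_self[of "1 / 16"] by (simp add: exp_minus field_simps)
      finally show "measure ?M {x \<in> space ?M. \<not> real ?k + \<mu> / 4 \<le> real (card (pzf_round ?G C x))} \<le> 16 / 17" .
    qed
  next
    case early
    \<comment> \<open>At least \<open>n / 2\<close> vertices are white, each forced with probability
      at least \<open>k^2 / (2 * n)\<close>. A quarter of this mean is the increment
      \<open>k^2 / 16\<close> in \<open>loglog_growth\<close>; it is only 1/16 at
      \<open>k = 1\<close>.\<close>
    define \<mu> where "\<mu> = real ?k ^ 2 / 4"
    have "real ?k ^ 2 < real n" using early(2) by (metis of_nat_less_iff of_nat_power)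
    moreover have "q / (2 * m) \<le> q / (m - 1 + q)" if "q < m" "0 < m - 1 + q" "0 \<le> q" for m q :: real
      using that by (intro divide_left_mono) auto
    ultimately have "real ?k ^ 2 / (2 * real n) \<le> real ?k ^ 2 / (real n - 1 + real ?k ^ 2)"
      using denom by simp
    hence "real ?k ^ 2 / (2 * real n) \<le> 1 - miss_prob n ?k" using ge by linarith
    moreover have "real n / 2 \<le> real (n - ?k)" using early k by simp
    ultimately have "(real n / 2) * (real ?k ^ 2 / (2 * real n)) \<le> real (n - ?k) * (1 - miss_prob n ?k)"
      by (intro mult_mono) auto
    hence mu: "\<mu> \<le> real (n - ?k) * (1 - miss_prob n ?k)" using k by (simp add: \<mu>_def)
    show ?thesis
    proof (rule bound[of "\<lambda>D. real ?k + \<mu> / 4 \<le> real (card D)"])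
      show "?good x" if "real ?k + \<mu> / 4 \<le> real (card (pzf_round ?G C x))" for x
      proof -
        have "loglog ?k + 1 / 49 \<le> loglog (real ?k + \<mu> / 4)"
          using loglog_growth[of "real ?k"] k by (simp add: \<mu>_def)
        also have "\<dots> \<le> loglog (card (pzf_round ?G C x))"
          using that k by (intro loglog_mono) (auto simp: \<mu>_def intro: add_increasing2)
        finally have "loglog ?k + 1 / 49 \<le> loglog (card (pzf_round ?G C x))" .
        moreover have "loglog ?k \<le> loglog n" using k by (intro loglog_mono) auto
        ultimately show ?thesis using early k by (auto simp: stage_def)
      qed
      have "measure ?M {x \<in> space ?M. \<not> real ?k + \<mu> / 4 \<le> real (card (pzf_round ?G C x))} \<le> exp (- (\<mu> / 4))"
        by (rule prob_growth_complete[OF C(1) _ mu]) (simp add: \<mu>_def)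
      also have "\<dots> \<le> exp (- (1 / 16))"
        using k one_le_power[of "real ?k" 2] by (simp add: \<mu>_def)
      also have "\<dots> \<le> 16 / 17"
        using exp_ge_add_one_self[of "1 / 16"] by (simp add: exp_minus field_simps)
      finally show "measure ?M {x \<in> space ?M. \<not> real ?k + \<mu> / 4 \<le> real (card (pzf_round ?G C x))} \<le> 16 / 17" .
    qed
  qed
qed

lemma ept_from_complete_le:
  assumes v: "v < n" and n: "real n * exp (- (real n / 64)) \<le> 16 / 17"
  shows "ept_from (complete_pair_graph n) {v} \<le> ennreal (833 * loglog n + 51)"
proof -
  let ?G = "complete_pair_graph n"
  let ?M = "pzf_round_space ?G"
  interpret prob_space ?M by (rule prob_space_pzf_round_space)
  \<comment> \<open>The remaining potential, scaled by 833 = 17 * 49: a good round lowers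
    \<open>h\<close> by at least 17 and has probability at least 1/17, so the expected loss is at
    least 1.\<close>
  define h where "h = (\<lambda>D :: nat set. 833 * (loglog n + 3 / 49 - stage n (card D)))"
  have fin: "finite (pverts ?G)" by simp
  have h_nonneg: "0 \<le> h D" if "1 \<le> card D" for D
    using stage_le[OF that, of n] by (simp add: h_def)
  have "ept_from ?G {v} \<le> ennreal (h {v})"
  proof (rule ept_from_le_drift[where h = "\<lambda>D. ennreal (h D)"])
    fix C assume C: "C \<subset> pverts ?G" "C \<noteq> {}"
    hence C': "C \<subseteq> pverts ?G" and C'': "C \<subset> {..<n}" by auto
    have k: "1 \<le> card C"
      using psubset_lessThan_card[OF C''] C(2) by (auto simp: Suc_le_eq card_gt_0_iff)
    have mono: "card C \<le> card (pzf_round ?G C x)" for x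
      using card_pzf_round_bounds(1)[of C n x] C'' by auto
    let ?stuck = "\<lambda>D. \<not> stage n (card C) + 1 / 49 \<le> stage n (card D)"
    have "(\<integral>x. h (pzf_round ?G C x) \<partial>?M) \<le> (\<integral>x. h C - 17 + 17 * of_bool (?stuck (pzf_round ?G C x)) \<partial>?M)"
    proof (intro integral_mono integrable_pzf_round[OF fin C'])
      fix x
      show "h (pzf_round ?G C x) \<le> h C - 17 + 17 * of_bool (?stuck (pzf_round ?G C x))"
        using stage_mono[OF k mono, of n x] by (auto simp: h_def)
    qed
    also have "\<dots> = h C - 17 + 17 * (\<integral>x. of_bool (?stuck (pzf_round ?G C x)) \<partial>?M)"
      using integrable_pzf_round[OF fin C', of "\<lambda>D. of_bool (?stuck D)"]
      by (simp add: prob_space del: of_bool_not_iff)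
    also have "\<dots> \<le> h C - 17 + 17 * (16 / 17)"
      using prob_stage_stuck[OF C'' C(2) n]
      by (intro add_left_mono mult_left_mono) (subst expectation_of_bool_pzf_round[OF fin C'], auto)
    finally have le: "1 + (\<integral>x. h (pzf_round ?G C x) \<partial>?M) \<le> h C" by simp
    have nonneg: "0 \<le> h (pzf_round ?G C x)" for x
      using mono[of x] k by (intro h_nonneg) simp
    have "1 + (\<integral>\<^sup>+ x. ennreal (h (pzf_round ?G C x)) \<partial>?M) = ennreal (1 + (\<integral>x. h (pzf_round ?G C x) \<partial>?M))"
      using nonneg by (subst nn_integral_eq_integral[OF integrable_pzf_round[OF fin C']])
        (auto simp: ennreal_plus)
    thus "1 + (\<integral>\<^sup>+ x. ennreal (h (pzf_round ?G C x)) \<partial>?M) \<le> ennreal (h C)"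
      using le by (simp add: ennreal_leI)
  qed (use v in auto)
  also have "h {v} \<le> 833 * loglog n + 51"
  proof -
    have "1 \<le> real n" using v by simp
    \<comment> \<open>Hence \<open>h {v}\<close> is at most its value for stage 0, with additive
      term 833 * 3 / 49 = 51.\<close>
    hence "0 \<le> stage n 1" using loglog_nonneg[of "real n"] by (auto simp: stage_def loglog_def)
    thus ?thesis by (simp add: h_def)
  qed
  finally show ?thesis by (simp add: ennreal_leI)
qed

theorem theorem3p1:
  shows "\<exists>c1 c2 :: real. \<exists>n0 :: nat. c1 > 0 \<and> c2 > 0 \<and> n0 \<ge> 1 \<and>
    (\<forall>n\<ge>n0. ennreal (c1 * ln (ln (real n))) \<le> ept (complete_pair_graph n) \<and>
             ept (complete_pair_graph n) \<le> ennreal (c2 * ln (ln (real n))))"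
proof -
  have "eventually (\<lambda>n. real n * exp (- (real n / 64)) \<le> 16 / 17) sequentially"
    by real_asymp
  \<comment> \<open>Raising the factor from 833 to 834 eventually absorbs both the constant 51 and
    the 1 inside the logarithm.\<close>
  moreover have "eventually (\<lambda>n. 833 * ln (1 + ln (real n)) + 51 \<le> 834 * ln (ln (real n))) sequentially"
    by real_asymp
  moreover have "eventually (\<lambda>n. 3 \<le> n) sequentially"
    by (rule eventually_ge_at_top)
  ultimately have "eventually (\<lambda>n. ennreal (1 / 4 * ln (ln (real n))) \<le> ept (complete_pair_graph n) \<and>
      ept (complete_pair_graph n) \<le> ennreal (834 * ln (ln (real n)))) sequentially"
  proof eventually_elim
    case (elim n)
    let ?G = "complete_pair_graph n"
    have fin: "finite (pverts ?G)" "pverts ?G \<noteq> {}"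
      using elim(3) by (simp_all add: lessThan_empty_iff)
    have "0 < ln (real n)" using elim(3) by simp
    hence "1 / 4 * ln (ln (real n)) \<le> loglog n / 4"
      by (simp add: loglog_def)
    hence "ennreal (1 / 4 * ln (ln (real n))) \<le> ennreal (loglog n / 4)"
      by (rule ennreal_leI)
    also have "\<dots> \<le> ept ?G"
      unfolding ept_def using fin elim(3) by (intro Min.boundedI) (auto intro: ept_from_complete_ge)
    finally have lower: "ennreal (1 / 4 * ln (ln (real n))) \<le> ept ?G" .
    have "ept ?G \<le> ept_from ?G {0}"
      unfolding ept_def using fin elim(3) by (intro Min_le) auto
    also have "\<dots> \<le> ennreal (833 * loglog n + 51)"
      using elim(1,3) by (intro ept_from_complete_le) auto
    also have "\<dots> \<le> ennreal (834 * ln (ln (real n)))"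
      using elim(2) by (intro ennreal_leI) (simp add: loglog_def)
    finally show ?case using lower by blast
  qed
  then obtain N where "\<And>n. n \<ge> N \<Longrightarrow> ennreal (1 / 4 * ln (ln (real n))) \<le> ept (complete_pair_graph n) \<and>
      ept (complete_pair_graph n) \<le> ennreal (834 * ln (ln (real n)))"
    unfolding eventually_sequentially by blast
  thus ?thesis
    by (intro exI[of _ "1/4"] exI[of _ 834] exI[of _ "max 1 N"]) auto
qed

end
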